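(* Let $a > 0$ and $c \geq 1$. Let $\nu$ be a probability measure on $\mathbb{Z}$ whose probability mass function belongs to the class $\mathcal{Q}(a,c)$. Let $\mu$ be a centered log-concave probability measure on $\mathbb{Z}$ with variance bounded by $1$ and whose support is included in the support of $\nu$. Let $Y$ denote a random variable with distribution $\mu$, and assume that $$ \mathbb{E}[e^{2aY^2}] < +\infty. $$ Then $$ d_{\chi^2}(\mu || \nu) \leq c \left( d_{TV}(\mu, \nu) + \sqrt{d_{TV}(\mu, \nu)} \right) + c \sqrt{\mathbb{E}[e^{2a Y^2}]}\, \sqrt{2}\, \exp\left(-\frac{1}{12} \sqrt{\frac{1}{a} \log \left( 1 + \frac{1}{\sqrt{d_{TV}(\mu, \nu)}} \right)} \right), $$ where the right-hand side is interpreted as $0$ when $d_{TV}(\mu,\nu)=0$.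
   Context: For $a>0$ and $c\geq 1$, $\mathcal{Q}(a,c)$ is the class of functions $q\colon \mathbb{Z}\to[0,1]$ such that for all $k$ in $\mathrm{Supp}(q) = \{k\in\mathbb{Z} : q(k)>0\}$, $$\log\left(\frac{1}{q(k)}\right) \leq a k^2 + \log(c).$$ A probability measure on $\mathbb{Z}$ with probability mass function $p$ is log-concave if $p(k)^2 \geq p(k-1)p(k+1)$ for all $k \in \mathbb{Z}$ and its support $\{k\in\mathbb{Z} : p(k)>0\}$ is an integer interval (a set of consecutive integers, possibly infinite). It is centered if its mean is $0$. The total variation distance is normalized as $d_{TV}(\mu,\nu) = 2\sup_{A}|\mu(A)-\nu(A)| = \sum_{k\in\mathbb{Z}} |\mu(\{k\})-\nu(\{k\})|$. The $\chi^2$-divergence is the $f$-divergence with $f(x)=(x-1)^2$, i.e. (when the support of $\mu$ is included in that of $\nu$) $d_{\chi^2}(\mu||\nu) = \sum_{k : \nu(\{k\})>0} \nu(\{k\}) \left(\frac{\mu(\{k\})}{\nu(\{k\})}-1\right)^2$. $\log$ is the natural logarithm. *)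

theory Defs
  imports "HOL-Probability.Probability"
begin

definition class_Q :: "real \<Rightarrow> real \<Rightarrow> (int \<Rightarrow> real) set" where
  "class_Q a c =
     {q. (\<forall>k. 0 \<le> q k \<and> q k \<le> 1) \<and>
         (\<forall>k. q k > 0 \<longrightarrow> ln (1 / q k) \<le> a * (real_of_int k)\<^sup>2 + ln c)}"

definition integer_interval :: "int set \<Rightarrow> bool" where
  "integer_interval S \<longleftrightarrow> (\<forall>i\<in>S. \<forall>k\<in>S. \<forall>j. i \<le> j \<and> j \<le> k \<longrightarrow> j \<in> S)"

definition log_concave_pmf :: "int pmf \<Rightarrow> bool" where
  "log_concave_pmf \<mu> \<longleftrightarrow>
     (\<forall>k. (pmf \<mu> k)\<^sup>2 \<ge> pmf \<mu> (k - 1) * pmf \<mu> (k + 1)) \<and>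
     integer_interval (set_pmf \<mu>)"

text \<open>The integrability conjuncts rule out the default value 0 that the Bochner integral takes
  when the mean or the variance does not exist.\<close>

definition centered :: "int pmf \<Rightarrow> bool" where
  "centered \<mu> \<longleftrightarrow>
     integrable (measure_pmf \<mu>) real_of_int \<and> measure_pmf.expectation \<mu> real_of_int = 0"

definition variance_at_most :: "real \<Rightarrow> int pmf \<Rightarrow> bool" where
  "variance_at_most v \<mu> \<longleftrightarrow>
     integrable (measure_pmf \<mu>) (\<lambda>k. (real_of_int k)\<^sup>2) \<and>
     measure_pmf.variance \<mu> real_of_int \<le> v"

text \<open>Normalised with the factor 2, so that the values range over \<open>[0, 2]\<close>.\<close>

definition tv_dist :: "int pmf \<Rightarrow> int pmf \<Rightarrow> real" where
  "tv_dist \<mu> \<nu> = 2 * (SUP A. \<bar>measure (measure_pmf \<mu>) A - measure (measure_pmf \<nu>) A\<bar>)"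

text \<open>Extended-valued, since the sum may diverge. This is the chi-squared divergence when
  the support of \<open>\<mu>\<close> is included in that of \<open>\<nu>\<close>.\<close>

definition chi2_div :: "int pmf \<Rightarrow> int pmf \<Rightarrow> ennreal" where
  "chi2_div \<mu> \<nu> =
     (\<integral>\<^sup>+ k. ennreal (pmf \<nu> k * (pmf \<mu> k / pmf \<nu> k - 1)\<^sup>2) \<partial>count_space {k. pmf \<nu> k > 0})"

end

theory Submission
  imports Defs
begin

text \<open>
  Write \<open>p\<close>, \<open>q\<close> for the mass functions of \<open>\<mu>\<close>, \<open>\<nu>\<close> and \<open>d\<close> for their distance. The class condition
  is the lower bound \<open>1 / q k \<le> c * exp (a * k\<^sup>2)\<close>, so a summand \<open>(p - q)\<^sup>2 / q\<close> of the divergence can be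
  compared with \<open>\<bar>p - q\<bar>\<close> as long as \<open>exp (a * k\<^sup>2)\<close> is moderate. The sum is cut at the \<open>t\<close> with
  \<open>exp (a * t\<^sup>2) = 1 + 1 / sqrt d\<close>.

  For \<open>\<bar>k\<bar> \<le> t\<close> the summand is at most \<open>c * (1 + 1 / sqrt d) * \<bar>p - q\<bar>\<close>, and these terms add up to at
  most \<open>c * (d + sqrt d)\<close>. Points with \<open>p \<le> q\<close> obey the same bound wherever they lie, since there
  \<open>(q - p)\<^sup>2 / q \<le> q - p\<close>. For the remaining points, with \<open>\<bar>k\<bar> > t\<close> and \<open>p > q\<close>, the summand is at most
  \<open>p\<^sup>2 / q \<le> c * p * exp (a * k\<^sup>2)\<close>, and the Cauchy-Schwarz inequality bounds their sum by
  \<open>c * sqrt (E exp (2 * a * Y\<^sup>2)) * sqrt (P (\<bar>Y\<bar> > t))\<close>.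

  What is left is the tail estimate \<open>P (\<bar>Y\<bar> > t) \<le> 2 * exp (- t / 6)\<close>
  (\<open>log_concave_pmf_tail_bound\<close>), where log-concavity enters. For a log-concave law the
  quotients \<open>P (Y \<ge> n + m) / P (Y \<ge> n)\<close> decrease in \<open>n\<close>
  (\<open>log_concave_pmf_tail_ratio_antimono\<close>), so one definite drop of the tail near the mean
  propagates to geometric decay. Chebyshev's inequality supplies this drop: it puts mass at
  most 1/9 outside \<open>{-2..2}\<close>.
\<close>

section \<open>Tails of log-concave distributions\<close>

lemma log_concave_pmf_support:
  assumes "log_concave_pmf \<mu>" "pmf \<mu> i > 0" "pmf \<mu> k > 0" "i \<le> j" "j \<le> k"
  shows "pmf \<mu> j > 0"
proof -
  have "i \<in> set_pmf \<mu>" "k \<in> set_pmf \<mu>"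
    using assms(2,3) by (auto simp: set_pmf_iff)
  then have "j \<in> set_pmf \<mu>"
    using assms(1,4,5) unfolding log_concave_pmf_def integer_interval_def by blast
  then show ?thesis by (simp add: pmf_positive)
qed

lemma log_concave_pmf_ratio_step:
  assumes lc: "log_concave_pmf \<mu>" and "j \<le> k"
  shows "pmf \<mu> (k + 1) * pmf \<mu> j \<le> pmf \<mu> k * pmf \<mu> (j + 1)"
  using assms(2)
proof (induction k rule: int_ge_induct)
  case base
  then show ?case by (simp add: mult.commute)
next
  case (step k)
  show ?case
  proof (cases "pmf \<mu> (k + 2) = 0 \<or> pmf \<mu> j = 0")
    case True
    then show ?thesis by (auto simp: add.commute add.left_commute)
  next
    case False
    then have "pmf \<mu> (k + 2) > 0" "pmf \<mu> j > 0" by (simp_all add: pmf_pos)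
    then have kpos: "pmf \<mu> k > 0"
      using log_concave_pmf_support[OF lc, of j "k + 2" k] step.hyps by simp
    have "pmf \<mu> ((k + 1) - 1) * pmf \<mu> ((k + 1) + 1) \<le> (pmf \<mu> (k + 1))\<^sup>2"
      using lc unfolding log_concave_pmf_def by blast
    then have lck: "pmf \<mu> k * pmf \<mu> (k + 2) \<le> pmf \<mu> (k + 1) * pmf \<mu> (k + 1)"
      by (simp add: power2_eq_square add.assoc)
    have "pmf \<mu> k * (pmf \<mu> (k + 2) * pmf \<mu> j) \<le> (pmf \<mu> (k + 1) * pmf \<mu> (k + 1)) * pmf \<mu> j"
      using mult_right_mono[OF lck, of "pmf \<mu> j"] by (simp add: mult.assoc)
    also have "\<dots> \<le> pmf \<mu> k * (pmf \<mu> (k + 1) * pmf \<mu> (j + 1))"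
      using mult_left_mono[OF step.IH, of "pmf \<mu> (k + 1)"] by (simp add: mult_ac)
    finally have "pmf \<mu> (k + 2) * pmf \<mu> j \<le> pmf \<mu> (k + 1) * pmf \<mu> (j + 1)"
      using kpos by simp
    then show ?thesis by (simp add: add.assoc)
  qed
qed

text \<open>Cross-multiplied form of the fact that the ratios \<open>p (k + m) / p k\<close> of a log-concave
  sequence decrease in \<open>k\<close>. The interval condition on the support is essential for it:
  the local inequality alone would allow mass to reappear after a gap of two zeros.\<close>

lemma log_concave_pmf_ratio_antimono:
  assumes lc: "log_concave_pmf \<mu>" and "j \<le> k"
  shows "pmf \<mu> (k + int m) * pmf \<mu> j \<le> pmf \<mu> k * pmf \<mu> (j + int m)"
proof (induction m)
  case 0
  then show ?case by simp
next
  case (Suc m)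
  show ?case
  proof (cases "pmf \<mu> (k + int (Suc m)) = 0 \<or> pmf \<mu> j = 0")
    case True
    then show ?thesis by auto
  next
    case False
    then have "pmf \<mu> (k + int (Suc m)) > 0" "pmf \<mu> j > 0" by (simp_all add: pmf_pos)
    then have jpos: "pmf \<mu> (j + int m) > 0"
      using log_concave_pmf_support[OF lc, of j "k + int (Suc m)" "j + int m"] assms(2) by simp
    have step: "pmf \<mu> (k + int m + 1) * pmf \<mu> (j + int m)
        \<le> pmf \<mu> (k + int m) * pmf \<mu> (j + int m + 1)"
      using log_concave_pmf_ratio_step[OF lc, of "j + int m" "k + int m"] assms(2) by simp
    have "pmf \<mu> (j + int m) * (pmf \<mu> (k + int m + 1) * pmf \<mu> j)
        \<le> (pmf \<mu> (k + int m) * pmf \<mu> j) * pmf \<mu> (j + int m + 1)"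
      using mult_right_mono[OF step, of "pmf \<mu> j"] by (simp add: mult_ac)
    also have "\<dots> \<le> pmf \<mu> (j + int m) * (pmf \<mu> k * pmf \<mu> (j + int m + 1))"
      using mult_right_mono[OF Suc.IH, of "pmf \<mu> (j + int m + 1)"] by (simp add: mult_ac)
    finally have "pmf \<mu> (k + int m + 1) * pmf \<mu> j \<le> pmf \<mu> k * pmf \<mu> (j + int m + 1)"
      using jpos by simp
    then show ?thesis by (simp add: algebra_simps)
  qed
qed

lemma measure_pmf_mono_scaled:
  assumes "\<And>x. x \<in> A \<Longrightarrow> s * pmf p x \<le> r * pmf q x"
  shows "s * measure (measure_pmf p) A \<le> r * measure (measure_pmf q) A"
proof -
  have "(\<integral>x. s * pmf p x \<partial>count_space A) \<le> (\<integral>x. r * pmf q x \<partial>count_space A)"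
    using assms by (intro integral_mono integrable_mult_right integrable_pmf) simp_all
  then show ?thesis by (simp add: integral_pmf)
qed

text \<open>Along \<open>k\<close>, the difference \<open>p (k + m) - r * p k\<close> is first nonnegative and then nonpositive,
  because the ratios decrease. Hence either it is nonpositive from \<open>n\<close> on, or it is nonnegative
  before \<open>n\<close> and its sum from \<open>n\<close> on is at most its sum from \<open>i\<close> on.\<close>

lemma log_concave_pmf_tail_ratio_antimono:
  assumes lc: "log_concave_pmf \<mu>" and "r \<ge> 0" and "i \<le> n"
    and le: "measure (measure_pmf \<mu>) {i + int m..} \<le> r * measure (measure_pmf \<mu>) {i..}"
  shows "measure (measure_pmf \<mu>) {n + int m..} \<le> r * measure (measure_pmf \<mu>) {n..}"
proof -
  define \<sigma> where "\<sigma> = map_pmf (\<lambda>k. k - int m) \<mu>"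
  have pmf_\<sigma>: "pmf \<sigma> k = pmf \<mu> (k + int m)" for k
    using pmf_map_inj'[of "\<lambda>k. k - int m" \<mu> "k + int m"] by (simp add: \<sigma>_def inj_def)
  have tail_\<sigma>: "measure (measure_pmf \<sigma>) {k..} = measure (measure_pmf \<mu>) {k + int m..}" for k
  proof -
    have "(\<lambda>k. k - int m) -` {k..} = {k + int m..}" by auto
    then show ?thesis by (simp add: \<sigma>_def)
  qed
  show ?thesis
  proof (cases "\<forall>k\<ge>n. pmf \<sigma> k \<le> r * pmf \<mu> k")
    case True
    then have "measure (measure_pmf \<sigma>) {n..} \<le> r * measure (measure_pmf \<mu>) {n..}"
      using measure_pmf_mono_scaled[of "{n..}" 1 \<sigma> r \<mu>] by simp
    then show ?thesis by (simp add: tail_\<sigma>)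
  next
    case False
    then obtain k where k: "n \<le> k" "r * pmf \<mu> k < pmf \<sigma> k" by force
    have "r * pmf \<mu> j \<le> pmf \<sigma> j" if "j < n" for j
    proof (cases "pmf \<mu> j = 0")
      case False
      then have jpos: "pmf \<mu> j > 0" by (simp add: pmf_pos)
      have "0 \<le> r * pmf \<mu> k" using \<open>r \<ge> 0\<close> by simp
      then have "pmf \<mu> (k + int m) > 0" using k(2) by (simp add: pmf_\<sigma>)
      then have kpos: "pmf \<mu> k > 0"
        using log_concave_pmf_support[OF lc jpos, of "k + int m" k] that k(1) by simp
      have "pmf \<mu> k * (r * pmf \<mu> j) \<le> pmf \<sigma> k * pmf \<mu> j"
        using mult_right_mono[of "r * pmf \<mu> k" "pmf \<sigma> k" "pmf \<mu> j"] k(2) by (simp add: mult_ac)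
      also have "\<dots> \<le> pmf \<mu> k * pmf \<sigma> j"
        using log_concave_pmf_ratio_antimono[OF lc, of j k m] that k(1) by (simp add: pmf_\<sigma>)
      finally show ?thesis using kpos by simp
    qed simp
    then have before: "r * measure (measure_pmf \<mu>) {i..<n} \<le> measure (measure_pmf \<sigma>) {i..<n}"
      using measure_pmf_mono_scaled[of "{i..<n}" r \<mu> 1 \<sigma>] by simp
    have split: "measure (measure_pmf p) {i..}
        = measure (measure_pmf p) {i..<n} + measure (measure_pmf p) {n..}" for p :: "int pmf"
    proof -
      have "{i..} = {i..<n} \<union> {n..}" using \<open>i \<le> n\<close> by auto
      then show ?thesis
        by (simp add: measure_pmf.finite_measure_Union ivl_disj_int)
    qed
    have "measure (measure_pmf \<sigma>) {i..} \<le> r * measure (measure_pmf \<mu>) {i..}"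
      using le by (simp add: tail_\<sigma>)
    then have "measure (measure_pmf \<sigma>) {n..} \<le> r * measure (measure_pmf \<mu>) {n..}"
      using before by (simp add: split distrib_left)
    then show ?thesis by (simp add: tail_\<sigma>)
  qed
qed

lemma exp_5_6_le: "exp (5 / 6 :: real) \<le> 3"
  using exp_le order_trans[of "exp (5/6)" "exp (1::real)" 3] by simp

text \<open>Passing from \<open>-2\<close> to \<open>3\<close> divides the tail by at least \<open>(1 - 1/9) / (1/9) = 8\<close>, hence so does
  every later step of length 5, which beats the required factor \<open>exp (5 / 6)\<close>. The tails at
  \<open>3, \<dots>, 7\<close> start the induction, since \<open>1/9 \<le> exp (- 7 / 6)\<close>.\<close>

lemma log_concave_pmf_right_tail:
  assumes lc: "log_concave_pmf \<mu>"
    and out: "measure (measure_pmf \<mu>) {k. 3 \<le> \<bar>k\<bar>} \<le> 1 / 9"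
    and "n \<ge> 3"
  shows "measure (measure_pmf \<mu>) {n..} \<le> exp (- real_of_int n / 6)"
proof -
  have tail3: "measure (measure_pmf \<mu>) {3..} \<le> 1 / 9"
  proof -
    have "measure (measure_pmf \<mu>) {3..} \<le> measure (measure_pmf \<mu>) {k. 3 \<le> \<bar>k\<bar>}"
      by (intro measure_pmf.finite_measure_mono) auto
    then show ?thesis using out by linarith
  qed
  have "measure (measure_pmf \<mu>) (UNIV - {-2..}) \<le> measure (measure_pmf \<mu>) {k. 3 \<le> \<bar>k\<bar>}"
    by (intro measure_pmf.finite_measure_mono) auto
  then have "8 / 9 \<le> measure (measure_pmf \<mu>) {-2..}"
    using out measure_pmf.prob_compl[of "{-2..}" \<mu>] by simp
  then have drop: "measure (measure_pmf \<mu>) {-2 + int 5..} \<le> 1 / 8 * measure (measure_pmf \<mu>) {-2..}"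
    using tail3 by simp
  have n3: "n = 3 + int (nat (n - 3))" using \<open>n \<ge> 3\<close> by simp
  have "measure (measure_pmf \<mu>) {3 + int j..} \<le> exp (- real (3 + j) / 6)" for j
  proof (induction j rule: less_induct)
    case (less j)
    show ?case
    proof (cases "j < 5")
      case True
      have "exp (7 / 6 :: real) \<le> exp (5 / 6) * exp (5 / 6)"
        by (simp flip: exp_add)
      also have "\<dots> \<le> 3 * 3" using exp_5_6_le by (intro mult_mono) simp_all
      finally have "1 / 9 \<le> exp (- 7 / 6 :: real)" by (simp add: exp_minus field_simps)
      also have "\<dots> \<le> exp (- real (3 + j) / 6)" using True by simp
      finally have "1 / 9 \<le> exp (- real (3 + j) / 6)" .
      moreover have "measure (measure_pmf \<mu>) {3 + int j..} \<le> measure (measure_pmf \<mu>) {3..}"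
        by (intro measure_pmf.finite_measure_mono) auto
      ultimately show ?thesis using tail3 by linarith
    next
      case False
      define i where "i = j - 5"
      have j: "j = i + 5" using False by (simp add: i_def)
      have "measure (measure_pmf \<mu>) {(3 + int i) + int 5..}
          \<le> 1 / 8 * measure (measure_pmf \<mu>) {3 + int i..}"
        by (rule log_concave_pmf_tail_ratio_antimono[OF lc _ _ drop]) simp_all
      also have "\<dots> \<le> exp (- 5 / 6) * exp (- real (3 + i) / 6)"
        using exp_5_6_le less.IH[of i] j
        by (intro mult_mono) (simp_all add: exp_minus field_simps)
      also have "\<dots> = exp (- real (3 + j) / 6)"
        by (simp add: j flip: exp_add) (simp add: field_simps)
      finally show ?thesis by (simp add: j add.assoc)
    qed
  qed
  from this[of "nat (n - 3)"] show ?thesis using n3 \<open>n \<ge> 3\<close> by simp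
qed

lemma log_concave_pmf_uminus:
  assumes "log_concave_pmf \<mu>"
  shows "log_concave_pmf (map_pmf uminus \<mu>)"
proof -
  have pmf: "pmf (map_pmf uminus \<mu>) k = pmf \<mu> (- k)" for k
    using pmf_map_inj'[of uminus \<mu> "- k"] by simp
  have "integer_interval (uminus ` set_pmf \<mu>)"
    unfolding integer_interval_def
  proof (intro ballI allI impI)
    fix i k j assume ik: "i \<in> uminus ` set_pmf \<mu>" "k \<in> uminus ` set_pmf \<mu>" "i \<le> j \<and> j \<le> k"
    then have "- k \<in> set_pmf \<mu>" "- i \<in> set_pmf \<mu>" "- k \<le> - j" "- j \<le> - i" by auto
    then have "- j \<in> set_pmf \<mu>"
      using assms unfolding log_concave_pmf_def integer_interval_def by blast
    then show "j \<in> uminus ` set_pmf \<mu>" by (metis image_eqI minus_minus)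
  qed
  moreover have "(pmf \<mu> (- k))\<^sup>2 \<ge> pmf \<mu> (- (k - 1)) * pmf \<mu> (- (k + 1))" for k
  proof -
    have "pmf \<mu> (- k - 1) * pmf \<mu> (- k + 1) \<le> (pmf \<mu> (- k))\<^sup>2"
      using assms unfolding log_concave_pmf_def by blast
    moreover have "- (k - 1) = - k + 1" "- (k + 1) = - k - 1" by simp_all
    ultimately show ?thesis by (simp add: mult.commute)
  qed
  ultimately show ?thesis unfolding log_concave_pmf_def pmf by simp
qed

text \<open>The factor 2 comes from adding the two one-sided tails; it also makes the bound trivial for
  \<open>t < 2\<close>, where the Chebyshev estimate at distance 3 says nothing.\<close>

lemma log_concave_pmf_tail_bound:
  assumes lc: "log_concave_pmf \<mu>" and "centered \<mu>" and "variance_at_most 1 \<mu>"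
    and "t \<ge> 0"
  shows "measure (measure_pmf \<mu>) {k. t < \<bar>real_of_int k\<bar>} \<le> 2 * exp (- t / 6)"
proof (cases "t < 2")
  case True
  have "exp (t / 6) \<le> exp (1 / 3)" using True by simp
  also have "\<dots> \<le> 1 + 1 / 3 + (1 / 3)\<^sup>2"
    by (rule exp_bound) simp_all
  finally have "1 \<le> 2 * exp (- t / 6)" by (simp add: exp_minus field_simps power2_eq_square)
  then show ?thesis using measure_pmf.prob_le_1 order_trans by blast
next
  case False
  have E: "measure_pmf.expectation \<mu> real_of_int = 0"
    and I: "integrable (measure_pmf \<mu>) (\<lambda>k. (real_of_int k)\<^sup>2)"
    and V: "measure_pmf.variance \<mu> real_of_int \<le> 1"
    using assms unfolding centered_def variance_at_most_def by auto
  have "measure (measure_pmf \<mu>) {k \<in> space (measure_pmf \<mu>).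
      3 \<le> \<bar>real_of_int k - measure_pmf.expectation \<mu> real_of_int\<bar>}
      \<le> measure_pmf.variance \<mu> real_of_int / 3\<^sup>2"
    using I by (intro measure_pmf.Chebyshev_inequality) simp_all
  also have "\<dots> \<le> 1 / 9" using V by simp
  finally have "measure (measure_pmf \<mu>) {k. 3 \<le> \<bar>real_of_int k\<bar>} \<le> 1 / 9"
    by (simp add: E)
  moreover have "{k. 3 \<le> \<bar>real_of_int k\<bar>} = {k. 3 \<le> \<bar>k\<bar>}" by auto
  ultimately have out: "measure (measure_pmf \<mu>) {k. 3 \<le> \<bar>k\<bar>} \<le> 1 / 9" by simp
  then have out': "measure (measure_pmf (map_pmf uminus \<mu>)) {k. 3 \<le> \<bar>k\<bar>} \<le> 1 / 9"
    by (simp add: vimage_def)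
  define n where "n = \<lfloor>t\<rfloor> + 1"
  have n3: "n \<ge> 3" using False unfolding n_def by linarith
  have tn: "t < real_of_int n" unfolding n_def by linarith
  have nle: "exp (- real_of_int n / 6) \<le> exp (- t / 6)" using tn by simp
  have "{k. t < \<bar>real_of_int k\<bar>} \<subseteq> {n..} \<union> uminus -` {n..}"
  proof
    fix k :: int assume "k \<in> {k. t < \<bar>real_of_int k\<bar>}"
    then have "\<lfloor>t\<rfloor> < \<bar>k\<bar>" by (simp add: floor_less_iff)
    then show "k \<in> {n..} \<union> uminus -` {n..}" by (auto simp: n_def)
  qed
  then have "measure (measure_pmf \<mu>) {k. t < \<bar>real_of_int k\<bar>}
      \<le> measure (measure_pmf \<mu>) ({n..} \<union> uminus -` {n..})"
    by (intro measure_pmf.finite_measure_mono) simp_all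
  also have "\<dots> \<le> measure (measure_pmf \<mu>) {n..} + measure (measure_pmf \<mu>) (uminus -` {n..})"
    by (rule measure_Un_le) simp_all
  also have "\<dots> = measure (measure_pmf \<mu>) {n..} + measure (measure_pmf (map_pmf uminus \<mu>)) {n..}"
    by simp
  also have "\<dots> \<le> exp (- t / 6) + exp (- t / 6)"
    using log_concave_pmf_right_tail[OF lc out n3]
      log_concave_pmf_right_tail[OF log_concave_pmf_uminus[OF lc] out' n3] nle
    by linarith
  finally show ?thesis by simp
qed

section \<open>Total variation distance\<close>

lemma measure_diff_le_tv_dist:
  "\<bar>measure (measure_pmf \<mu>) A - measure (measure_pmf \<nu>) A\<bar> \<le> tv_dist \<mu> \<nu> / 2"
proof -
  have "\<bar>measure (measure_pmf \<mu>) B - measure (measure_pmf \<nu>) B\<bar> \<le> 1" for B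
    using measure_pmf.prob_le_1[of \<mu> B] measure_pmf.prob_le_1[of \<nu> B]
      measure_nonneg[of "measure_pmf \<mu>" B] measure_nonneg[of "measure_pmf \<nu>" B]
    by linarith
  then have "bdd_above (range (\<lambda>B. \<bar>measure (measure_pmf \<mu>) B - measure (measure_pmf \<nu>) B\<bar>))"
    by (intro bdd_aboveI[of _ 1]) auto
  then show ?thesis unfolding tv_dist_def using cSUP_upper[of A UNIV] by simp
qed

lemma tv_dist_nonneg: "tv_dist \<mu> \<nu> \<ge> 0"
  using measure_diff_le_tv_dist[of \<mu> "{}" \<nu>] by simp

lemma tv_dist_eq_0D:
  assumes "tv_dist \<mu> \<nu> = 0"
  shows "\<mu> = \<nu>"
proof (rule pmf_eqI)
  fix k show "pmf \<mu> k = pmf \<nu> k"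
    using measure_diff_le_tv_dist[of \<mu> "{k}" \<nu>] assms by (simp add: measure_pmf_single)
qed

text \<open>The two sets on which one of the mass functions exceeds the other contribute at most
  half of the distance each.\<close>

lemma nn_integral_pmf_diff_le_tv_dist:
  "(\<integral>\<^sup>+ k. ennreal \<bar>pmf \<mu> k - pmf \<nu> k\<bar> \<partial>count_space UNIV) \<le> ennreal (tv_dist \<mu> \<nu>)"
proof -
  have int: "integrable (count_space UNIV) (\<lambda>k. \<bar>pmf \<mu> k - pmf \<nu> k\<bar>)"
    by (intro integrable_abs Bochner_Integration.integrable_diff integrable_pmf)
  define A where "A = {k. pmf \<nu> k < pmf \<mu> k}"
  have meas: "(\<integral>k. indicator B k * pmf p k \<partial>count_space UNIV) = measure (measure_pmf p) B"
    for B and p :: "int pmf"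
    using integral_restrict_space[of B "count_space UNIV" "pmf p"]
    by (simp add: integral_pmf restrict_count_space)
  have intI: "integrable (count_space UNIV) (\<lambda>k. indicator B k * pmf p k)"
    for B and p :: "int pmf"
    by (rule Bochner_Integration.integrable_bound[OF integrable_pmf[of UNIV p]])
      (auto simp: indicator_def)
  have "(\<integral>k. \<bar>pmf \<mu> k - pmf \<nu> k\<bar> \<partial>count_space UNIV)
      = (\<integral>k. (indicator A k * pmf \<mu> k - indicator A k * pmf \<nu> k)
          + (indicator (- A) k * pmf \<nu> k - indicator (- A) k * pmf \<mu> k) \<partial>count_space UNIV)"
    by (intro Bochner_Integration.integral_cong) (auto simp: A_def indicator_def)
  also have "\<dots> = (measure (measure_pmf \<mu>) A - measure (measure_pmf \<nu>) A)
      + (measure (measure_pmf \<nu>) (- A) - measure (measure_pmf \<mu>) (- A))"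
    by (simp add: intI meas)
  also have "\<dots> \<le> tv_dist \<mu> \<nu>"
    using measure_diff_le_tv_dist[of \<mu> A \<nu>] measure_diff_le_tv_dist[of \<mu> "- A" \<nu>] by linarith
  finally show ?thesis
    by (subst nn_integral_eq_integral[OF int]) (auto intro: ennreal_leI)
qed

section \<open>Bounding the chi-squared divergence\<close>

lemma chi2_div_self: "chi2_div \<mu> \<mu> = 0"
proof -
  have "(\<integral>\<^sup>+ k. ennreal (pmf \<mu> k * (pmf \<mu> k / pmf \<mu> k - 1)\<^sup>2) \<partial>count_space {k. pmf \<mu> k > 0})
      = (\<integral>\<^sup>+ k. 0 \<partial>count_space {k. pmf \<mu> k > 0})"
    by (intro nn_integral_cong) auto
  then show ?thesis by (simp add: chi2_div_def)
qed

lemma class_Q_inverse_le: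
  assumes "q \<in> class_Q a c" "q k > 0" "c > 0"
  shows "1 / q k \<le> c * exp (a * (real_of_int k)\<^sup>2)"
proof -
  have "1 / q k = exp (ln (1 / q k))" using assms(2) by simp
  also have "\<dots> \<le> exp (a * (real_of_int k)\<^sup>2 + ln c)"
    using assms(1,2) unfolding class_Q_def by (subst exp_le_cancel_iff) blast
  also have "\<dots> = c * exp (a * (real_of_int k)\<^sup>2)"
    using assms(3) by (simp add: exp_add)
  finally show ?thesis .
qed

lemma nn_integral_Cauchy_Schwarz_indicator:
  fixes f :: "'a \<Rightarrow> real"
  assumes f: "\<And>x. 0 \<le> f x" and int: "integrable (measure_pmf p) (\<lambda>x. (f x)\<^sup>2)"
  shows "(\<integral>\<^sup>+ x. ennreal (f x) * indicator A x \<partial>measure_pmf p)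
    \<le> ennreal (sqrt (measure_pmf.expectation p (\<lambda>x. (f x)\<^sup>2)) * sqrt (measure (measure_pmf p) A))"
proof -
  define E where "E = measure_pmf.expectation p (\<lambda>x. (f x)\<^sup>2)"
  define m where "m = measure (measure_pmf p) A"
  define I where "I = (\<integral>\<^sup>+ x. ennreal (f x) * indicator A x \<partial>measure_pmf p)"
  have E0: "E \<ge> 0" by (simp add: E_def)
  have m0: "m \<ge> 0" by (simp add: m_def)
  have "I\<^sup>2 \<le> (\<integral>\<^sup>+ x. (ennreal (f x))\<^sup>2 \<partial>measure_pmf p) * (\<integral>\<^sup>+ x. (indicator A x)\<^sup>2 \<partial>measure_pmf p)"
    unfolding I_def by (rule Cauchy_Schwarz_nn_integral) simp_all
  also have "(\<integral>\<^sup>+ x. (ennreal (f x))\<^sup>2 \<partial>measure_pmf p) = ennreal E"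
    using nn_integral_eq_integral[OF int] f by (simp add: E_def ennreal_power)
  also have "(\<integral>\<^sup>+ x. (indicator A x)\<^sup>2 \<partial>measure_pmf p) = (\<integral>\<^sup>+ x. indicator A x \<partial>measure_pmf p)"
    by (intro nn_integral_cong) (simp add: indicator_def)
  also have "\<dots> = ennreal m"
    by (simp add: m_def measure_pmf.emeasure_eq_measure)
  finally have le: "I\<^sup>2 \<le> ennreal (E * m)" using E0 m0 by (simp add: ennreal_mult)
  show ?thesis
  proof (cases I)
    case (real i)
    then have "i\<^sup>2 \<le> E * m" using le E0 m0 by (simp add: ennreal_power)
    then have "i \<le> sqrt E * sqrt m" using real_le_rsqrt[of i "E * m"] by (simp add: real_sqrt_mult)
    then show ?thesis using real by (simp add: I_def E_def m_def ennreal_leI)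
  next
    case top
    then show ?thesis using le by (simp add: power_eq_top_ennreal top_unique)
  qed
qed

text \<open>The number \<open>w\<close> stands for \<open>c * exp (a * k\<^sup>2)\<close> and \<open>far\<close> for \<open>\<bar>k\<bar> > t\<close>. The second term on the right
  serves only points that are far and have \<open>q < p\<close>: there \<open>(p - q)\<^sup>2 \<le> p\<close>, because \<open>p \<le> 1\<close>.\<close>

lemma chi2_summand_le:
  fixes p q :: real
  assumes "0 \<le> p" "p \<le> 1" "0 < q" "q \<le> 1" "1 / q \<le> w" "1 \<le> M" "0 \<le> w"
    and "\<not> far \<Longrightarrow> w \<le> M"
  shows "q * (p / q - 1)\<^sup>2 \<le> M * \<bar>p - q\<bar> + p * (w * of_bool far)"
proof -
  have eq: "q * (p / q - 1)\<^sup>2 = (p - q)\<^sup>2 / q"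
    using \<open>0 < q\<close> by (simp add: field_simps power2_eq_square)
  have rest: "0 \<le> p * (w * of_bool far)" using assms by simp
  consider "p \<le> q" | "q < p" "far" | "q < p" "\<not> far" by linarith
  then show ?thesis
  proof cases
    case 1
    have "(p - q)\<^sup>2 \<le> \<bar>p - q\<bar> * q"
      using 1 assms mult_left_mono[of "q - p" q "q - p"]
      by (simp add: power2_commute[of p] power2_eq_square[of "q - p"])
    then have "(p - q)\<^sup>2 / q \<le> \<bar>p - q\<bar>" using \<open>0 < q\<close> by (simp add: pos_divide_le_eq)
    also have "\<dots> \<le> M * \<bar>p - q\<bar>" using \<open>1 \<le> M\<close> by (simp add: mult_le_cancel_right1)
    finally show ?thesis using eq rest by linarith
  next
    case 2
    have "(p - q)\<^sup>2 \<le> p * 1"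
      using 2 assms unfolding power2_eq_square by (intro mult_mono) simp_all
    then have "(p - q)\<^sup>2 * (1 / q) \<le> p * w"
      using assms by (intro mult_mono) simp_all
    moreover have "0 \<le> M * \<bar>p - q\<bar>" using \<open>1 \<le> M\<close> by simp
    ultimately show ?thesis using eq 2 by simp
  next
    case 3
    have "(p - q)\<^sup>2 \<le> \<bar>p - q\<bar> * 1"
      using 3 assms unfolding power2_eq_square by (intro mult_mono) simp_all
    then have "(p - q)\<^sup>2 * (1 / q) \<le> \<bar>p - q\<bar> * M"
      using assms(3,5,8) 3 by (intro mult_mono) simp_all
    then show ?thesis using eq rest by (simp add: mult.commute)
  qed
qed

theorem theorem3p14:
  fixes a c :: real and \<mu> \<nu> :: "int pmf"
  assumes "a > 0" and "c \<ge> 1"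
    and "pmf \<nu> \<in> class_Q a c"
    and "log_concave_pmf \<mu>" and "centered \<mu>" and "variance_at_most 1 \<mu>"
    and "set_pmf \<mu> \<subseteq> set_pmf \<nu>"
    and "integrable (measure_pmf \<mu>) (\<lambda>y. exp (2 * a * (real_of_int y)\<^sup>2))"
  shows "chi2_div \<mu> \<nu> \<le> ennreal
    (let d = tv_dist \<mu> \<nu> in
     if d = 0 then 0
     else c * (d + sqrt d)
        + c * sqrt (measure_pmf.expectation \<mu> (\<lambda>y. exp (2 * a * (real_of_int y)\<^sup>2)))
            * sqrt 2 * exp (- (1 / 12) * sqrt (1 / a * ln (1 + 1 / sqrt d))))"
proof (cases "tv_dist \<mu> \<nu> = 0")
  case True
  then have "\<mu> = \<nu>" by (rule tv_dist_eq_0D)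
  then show ?thesis by (simp add: chi2_div_self)
next
  case False
  define d where "d = tv_dist \<mu> \<nu>"
  define t where "t = sqrt (1 / a * ln (1 + 1 / sqrt d))"
  define M where "M = c * (1 + 1 / sqrt d)"
  define E where "E = measure_pmf.expectation \<mu> (\<lambda>y. exp (2 * a * (real_of_int y)\<^sup>2))"
  define T where "T = {k. t < \<bar>real_of_int k\<bar>}"
  let ?e = "\<lambda>k. exp (a * (real_of_int k)\<^sup>2)"
  have d: "d > 0" using False tv_dist_nonneg[of \<mu> \<nu>] by (simp add: d_def)
  have "0 \<le> 1 / a * ln (1 + 1 / sqrt d)" using d \<open>a > 0\<close> by simp
  then have t2: "a * t\<^sup>2 = ln (1 + 1 / sqrt d)" and t0: "t \<ge> 0"
    using \<open>a > 0\<close> by (simp_all add: t_def)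
  have M1: "1 \<le> M" using d \<open>c \<ge> 1\<close> mult_mono[of 1 c 1 "1 + 1 / sqrt d"] by (simp add: M_def)
  have near: "c * ?e k \<le> M" if "k \<notin> T" for k
  proof -
    have "(real_of_int k)\<^sup>2 \<le> t\<^sup>2"
      using that power_mono[of "\<bar>real_of_int k\<bar>" t 2] by (simp add: T_def)
    then have "a * (real_of_int k)\<^sup>2 \<le> ln (1 + 1 / sqrt d)"
      using \<open>a > 0\<close> t2 mult_left_mono[of "(real_of_int k)\<^sup>2" "t\<^sup>2" a] by simp
    then have "?e k \<le> exp (ln (1 + 1 / sqrt d))" by (simp only: exp_le_cancel_iff)
    also have "\<dots> = 1 + 1 / sqrt d" using d by (simp add: add_pos_pos)
    finally show ?thesis using \<open>c \<ge> 1\<close> by (simp add: M_def)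
  qed
  have summand: "ennreal (pmf \<nu> k * (pmf \<mu> k / pmf \<nu> k - 1)\<^sup>2)
      \<le> ennreal M * ennreal \<bar>pmf \<mu> k - pmf \<nu> k\<bar>
        + ennreal c * (ennreal (pmf \<mu> k) * (ennreal (?e k) * indicator T k))"
    if "pmf \<nu> k > 0" for k
  proof -
    have "pmf \<nu> k * (pmf \<mu> k / pmf \<nu> k - 1)\<^sup>2
        \<le> M * \<bar>pmf \<mu> k - pmf \<nu> k\<bar> + pmf \<mu> k * (c * ?e k * of_bool (k \<in> T))"
      using class_Q_inverse_le[OF \<open>pmf \<nu> \<in> class_Q a c\<close> that] near M1 that \<open>c \<ge> 1\<close>
      by (intro chi2_summand_le) (simp_all add: pmf_le_1)
    then have "ennreal (pmf \<nu> k * (pmf \<mu> k / pmf \<nu> k - 1)\<^sup>2)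
        \<le> ennreal (M * \<bar>pmf \<mu> k - pmf \<nu> k\<bar> + pmf \<mu> k * (c * ?e k * of_bool (k \<in> T)))"
      by (rule ennreal_leI)
    also have "\<dots> = ennreal M * ennreal \<bar>pmf \<mu> k - pmf \<nu> k\<bar>
        + ennreal c * (ennreal (pmf \<mu> k) * (ennreal (?e k) * indicator T k))"
      using M1 \<open>c \<ge> 1\<close> by (cases "k \<in> T") (simp_all add: ennreal_mult mult_ac)
    finally show ?thesis .
  qed
  have "chi2_div \<mu> \<nu> \<le> (\<integral>\<^sup>+ k. ennreal M * ennreal \<bar>pmf \<mu> k - pmf \<nu> k\<bar>
      + ennreal c * (ennreal (pmf \<mu> k) * (ennreal (?e k) * indicator T k)) \<partial>count_space UNIV)"
    unfolding chi2_div_def nn_integral_count_space_indicator[of "{k. pmf \<nu> k > 0}", simplified]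
    by (intro nn_integral_mono) (use summand in \<open>auto simp: indicator_def\<close>)
  also have "\<dots> = ennreal M * (\<integral>\<^sup>+ k. ennreal \<bar>pmf \<mu> k - pmf \<nu> k\<bar> \<partial>count_space UNIV)
      + ennreal c * (\<integral>\<^sup>+ k. ennreal (?e k) * indicator T k \<partial>measure_pmf \<mu>)"
    by (simp add: nn_integral_add nn_integral_cmult nn_integral_measure_pmf)
  also have "\<dots> \<le> ennreal M * ennreal d + ennreal c * ennreal (sqrt E * sqrt (2 * exp (- t / 6)))"
  proof (intro add_mono mult_left_mono)
    show "(\<integral>\<^sup>+ k. ennreal \<bar>pmf \<mu> k - pmf \<nu> k\<bar> \<partial>count_space UNIV) \<le> ennreal d"
      unfolding d_def by (rule nn_integral_pmf_diff_le_tv_dist)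
    have sq: "(?e k)\<^sup>2 = exp (2 * a * (real_of_int k)\<^sup>2)" for k
      by (simp add: mult.assoc flip: exp_double)
    have "(\<integral>\<^sup>+ k. ennreal (?e k) * indicator T k \<partial>measure_pmf \<mu>)
        \<le> ennreal (sqrt E * sqrt (measure (measure_pmf \<mu>) T))"
      using nn_integral_Cauchy_Schwarz_indicator[of ?e \<mu> T] assms(8) by (simp add: sq E_def)
    also have "\<dots> \<le> ennreal (sqrt E * sqrt (2 * exp (- t / 6)))"
      using log_concave_pmf_tail_bound[OF assms(4-6) t0]
      by (intro ennreal_leI mult_left_mono real_sqrt_le_mono) (simp_all add: T_def E_def)
    finally show "(\<integral>\<^sup>+ k. ennreal (?e k) * indicator T k \<partial>measure_pmf \<mu>)
        \<le> ennreal (sqrt E * sqrt (2 * exp (- t / 6)))" .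
  qed simp_all
  also have "\<dots> = ennreal (M * d + c * (sqrt E * sqrt (2 * exp (- t / 6))))"
    using M1 d \<open>c \<ge> 1\<close> by (simp add: ennreal_mult E_def)
  also have "M * d = c * (d + sqrt d)"
    using d by (simp add: M_def field_simps real_div_sqrt)
  also have "sqrt (2 * exp (- t / 6)) = sqrt 2 * exp (- (1 / 12) * t)"
  proof -
    have "exp (- t / 6) = (exp (- (1 / 12) * t))\<^sup>2" by (simp flip: exp_double)
    then show ?thesis by (simp only: real_sqrt_mult real_sqrt_abs abs_exp_cancel)
  qed
  finally show ?thesis using d by (simp add: Let_def d_def t_def E_def mult.assoc)
qed

end
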